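(* Let $T$ be a weighted process tree of size $n$ and $\sigma=\langle\alpha_1,\dots,\alpha_p\rangle$ a run prefix of length $p\le n$ in $\mathrm{Sem}(T)$. The prefix-probability algorithm (which starts with $\rho_\sigma:=1$ and, for $i=1,\dots,p-1$ successively, performs $\rho_\sigma:=\rho_\sigma\times\frac{|T(\alpha_{i+1})|}{n-i}$, then returns $\rho_\sigma$) computes the probability $\rho_\sigma$ of the prefix $\sigma$ in $p-1$ steps, and with $\Theta(p)$ arithmetic operations.
   Context: A process tree is a plane rooted tree $T$ whose nodes carry pairwise distinct names (actions); its size $|T|$ is its number of nodes; $T(v)$ is the subtree of all descendants of the node $v$ (including $v$). "Weighted" means that each node $v$ stores the integer $|T(v)|$. For $T$ whose root has children $v_1,\dots,v_r$ from left to right, and $1\le i\le r$, the $i$-contraction $T\lhd i$ is the plane tree with root $v_i$ whose root-subtrees are, from left to right, $T(v_1),\dots,T(v_{i-1}),T(v_{i_1}),\dots,T(v_{i_m}),T(v_{i+1}),\dots,T(v_r)$, where $v_{i_1},\dots,v_{i_m}$ are the children of $v_i$ in order. The semantic tree $\mathrm{Sem}(T)$ is: $T$ itself if $T$ is a single node; otherwise the tree with the root $t$ of $T$ as root and root-subtrees $\mathrm{Sem}(T\lhd1),\dots,\mathrm{Sem}(T\lhd r)$. A concurrent run is a branch (root-to-leaf path) of $\mathrm{Sem}(T)$; a run prefix of length $p$ is the sequence of the first $p$ nodes of a run. The probability of a run prefix $\sigma$ is the probability that a uniformly random concurrent run of $T$ has $\sigma$ as prefix. *)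

theory Defs
  imports "HOL-Probability.Probability" "HOL-Library.Sublist" "HOL-Library.Landau_Symbols"
begin

section \<open>Process trees\<close>

datatype 'a ptree = Node (root: 'a) (children: "'a ptree list")

primrec tree_size :: "'a ptree \<Rightarrow> nat" where
  "tree_size (Node v ts) = Suc (sum_list (map tree_size ts))"

primrec nodes :: "'a ptree \<Rightarrow> 'a list" where
  "nodes (Node v ts) = v # concat (map nodes ts)"

primrec subtrees :: "'a ptree \<Rightarrow> 'a ptree set" where
  "subtrees (Node v ts) = insert (Node v ts) (\<Union> (set (map subtrees ts)))"

text \<open>Nodes are identified with their names, which are pairwise distinct in a process tree.\<close>

definition process_tree :: "'a ptree \<Rightarrow> bool" where
  "process_tree T \<longleftrightarrow> distinct (nodes T)"

definition subtree :: "'a ptree \<Rightarrow> 'a \<Rightarrow> 'a ptree" where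
  "subtree T v = (THE S. S \<in> subtrees T \<and> root S = v)"

text \<open>\<open>W v\<close> is the integer stored in the node \<open>v\<close>; its values outside the tree are irrelevant.\<close>

definition weighting :: "'a ptree \<Rightarrow> ('a \<Rightarrow> nat) \<Rightarrow> bool" where
  "weighting T W \<longleftrightarrow> (\<forall>v \<in> set (nodes T). W v = tree_size (subtree T v))"


section \<open>Semantic tree and concurrent runs\<close>

text \<open>Children are numbered from 0 here: \<open>contract T i\<close> is the $(i+1)$-contraction.\<close>

definition contract :: "'a ptree \<Rightarrow> nat \<Rightarrow> 'a ptree" where
  "contract T i =
     Node (root (children T ! i))
       (take i (children T) @ children (children T ! i) @ drop (Suc i) (children T))"

lemma tree_size_contract:
  assumes "i < length (children T)"
  shows "Suc (tree_size (contract T i)) = tree_size T"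
proof -
  obtain v ts where T: "T = Node v ts" by (cases T)
  obtain w us where w: "ts ! i = Node w us" by (cases "ts ! i")
  have "ts = take i ts @ ts ! i # drop (Suc i) ts"
    using assms T by (simp add: id_take_nth_drop)
  then have "sum_list (map tree_size ts) =
      sum_list (map tree_size (take i ts @ ts ! i # drop (Suc i) ts))"
    by (rule arg_cong)
  then show ?thesis using T w by (simp add: contract_def)
qed

function Sem :: "'a ptree \<Rightarrow> 'a ptree" where
  "Sem T = (if children T = [] then T
            else Node (root T) (map (\<lambda>i. Sem (contract T i)) [0..<length (children T)]))"
  by auto
termination
proof (relation "Wellfounded.measure tree_size")
  fix T :: "'a ptree" and i
  assume "i \<in> set [0..<length (children T)]"
  then show "(contract T i, T) \<in> Wellfounded.measure tree_size"
    using tree_size_contract[of i T] by simp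
qed simp

declare Sem.simps [simp del]

text \<open>One node sequence for every leaf.\<close>

primrec branches :: "'a ptree \<Rightarrow> 'a list list" where
  "branches (Node v ts) =
     (if ts = [] then [[v]] else map ((#) v) (concat (map branches ts)))"

definition runs :: "'a ptree \<Rightarrow> 'a list set" where
  "runs T = set (branches (Sem T))"

definition run_prefix :: "'a ptree \<Rightarrow> 'a list \<Rightarrow> bool" where
  "run_prefix T \<sigma> \<longleftrightarrow> (\<exists>r \<in> runs T. prefix \<sigma> r)"

definition prefix_probability :: "'a ptree \<Rightarrow> 'a list \<Rightarrow> real" where
  "prefix_probability T \<sigma> = measure_pmf.prob (pmf_of_set (runs T)) {r. prefix \<sigma> r}"

text \<open>
  Branches of a semantic tree can be identified with their node sequences: distinct
  branches have distinct sequences, so that \<^const>\<open>runs\<close> collapses nothing.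
\<close>

lemma process_tree_contract:
  assumes "process_tree T" "i < length (children T)"
  shows "process_tree (contract T i)"
proof -
  obtain v ts where T: "T = Node v ts" by (cases T)
  obtain w us where w: "ts ! i = Node w us" by (cases "ts ! i")
  have "ts = take i ts @ ts ! i # drop (Suc i) ts"
    using assms T by (simp add: id_take_nth_drop)
  then have "concat (map nodes ts) = concat (map nodes (take i ts @ ts ! i # drop (Suc i) ts))"
    by (rule arg_cong)
  then show ?thesis using assms T w
    by (auto simp: contract_def process_tree_def)
qed

lemma hd_branches: "b \<in> set (branches T) \<Longrightarrow> b \<noteq> [] \<and> hd b = root T"
  by (cases T) (auto split: if_splits)

lemma root_Sem [simp]: "root (Sem T) = root T"
  by (subst Sem.simps) simp

lemma root_in_nodes: "root T \<in> set (nodes T)"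
  by (cases T) simp

lemma distinct_roots: "distinct (concat (map nodes ts)) \<Longrightarrow> distinct (map root ts)"
proof (induction ts)
  case (Cons t ts)
  have "root t \<notin> set (map root ts)"
  proof
    assume "root t \<in> set (map root ts)"
    then obtain u where "u \<in> set ts" "root t = root u" by auto
    then have "root t \<in> set (concat (map nodes ts))"
      using root_in_nodes[of u] by auto
    then show False using Cons.prems root_in_nodes[of t] by auto
  qed
  then show ?case using Cons by simp
qed simp

lemma distinct_concat_branches:
  assumes "distinct (map root ts)" "\<And>t. t \<in> set ts \<Longrightarrow> distinct (branches t)"
  shows "distinct (concat (map branches ts))"
  using assms
proof (induction ts)
  case (Cons t ts)
  have "set (branches t) \<inter> set (branches u) = {}" if "u \<in> set ts" for u
  proof -
    have "root t \<noteq> root u" using Cons.prems(1) that by auto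
    then show ?thesis
      using hd_branches[of _ t] hd_branches[of _ u] by (metis disjoint_iff)
  qed
  then show ?case using Cons by auto
qed simp

lemma distinct_branches_Sem:
  assumes "process_tree T"
  shows "distinct (branches (Sem T))"
  using assms
proof (induction T rule: Sem.induct)
  case (1 T)
  show ?case
  proof (cases "children T = []")
    case True
    then show ?thesis by (cases T) (simp add: Sem.simps)
  next
    case False
    let ?us = "map (\<lambda>i. Sem (contract T i)) [0..<length (children T)]"
    have "map root ?us = map root (children T)"
      by (rule nth_equalityI) (auto simp: contract_def)
    moreover have "distinct (map root (children T))"
      using 1(2) by (cases T) (simp add: process_tree_def distinct_roots)
    ultimately have "distinct (concat (map branches ?us))"
      using 1 False by (intro distinct_concat_branches) (auto simp: process_tree_contract)
    then show ?thesis using False by (subst Sem.simps) (simp add: distinct_map)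
  qed
qed


section \<open>The algorithm\<close>

text \<open>
  A computation carries its result, the number of loop iterations (steps) and the number of
  arithmetic operations that it performed.
\<close>

datatype 'b counted = Counted (result: 'b) (steps: nat) (arith_ops: nat)

definition done_with :: "'b \<Rightarrow> 'b counted" where
  "done_with x = Counted x 0 0"

definition and_then :: "'b counted \<Rightarrow> ('b \<Rightarrow> 'c counted) \<Rightarrow> 'c counted" (infixl "\<bind>\<^sub>c" 54) where
  "m \<bind>\<^sub>c f = (let k = f (result m) in
     Counted (result k) (steps m + steps k) (arith_ops m + arith_ops k))"

definition sub_op :: "real \<Rightarrow> real \<Rightarrow> real counted" where
  "sub_op x y = Counted (x - y) 0 1"

definition div_op :: "real \<Rightarrow> real \<Rightarrow> real counted" where
  "div_op x y = Counted (x / y) 0 1"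

definition mul_op :: "real \<Rightarrow> real \<Rightarrow> real counted" where
  "mul_op x y = Counted (x * y) 0 1"

primrec for_loop :: "nat list \<Rightarrow> (nat \<Rightarrow> 'b \<Rightarrow> 'b counted) \<Rightarrow> 'b \<Rightarrow> 'b counted" where
  "for_loop [] body x = done_with x"
| "for_loop (i # is) body x =
     Counted () 1 0 \<bind>\<^sub>c (\<lambda>_. body i x) \<bind>\<^sub>c for_loop is body"

text \<open>Lists are indexed from 0, hence \<open>\<sigma> ! i\<close> is $\alpha_{i+1}$.\<close>

definition prefix_prob_alg :: "('a \<Rightarrow> nat) \<Rightarrow> nat \<Rightarrow> 'a list \<Rightarrow> real counted" where
  "prefix_prob_alg W n \<sigma> =
     for_loop [1..<length \<sigma>]
       (\<lambda>i \<rho>. sub_op (real n) (real i) \<bind>\<^sub>c (\<lambda>d.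
              div_op (real (W (\<sigma> ! i))) d \<bind>\<^sub>c (\<lambda>q.
              mul_op \<rho> q)))
       1"

end

(* By the hook length formula, T has |T|! / prod_v |T(v)| concurrent runs. Contracting the child
   v_i of the root removes the hook |T| and turns the hook |T(v_i)| into |T| - 1, so a uniform run
   of T moves from the root to v_i with probability |T(v_i)| / (|T| - 1); from then on it is a
   uniform run of the contraction, in which every node other than the root keeps its weight. *)
theory Submission
  imports Defs
begin

lemma sum_list_tree_size_children: "Suc (sum_list (map tree_size (children T))) = tree_size T"
  by (cases T) simp

lemma root_contract [simp]: "root (contract T i) = root (children T ! i)"
  by (simp add: contract_def)

subsection \<open>Counting concurrent runs\<close>

text \<open>The product of the hook lengths |T(v)| over all nodes, with the hook of the root written
  out.\<close>

primrec hook_prod :: "'a ptree \<Rightarrow> nat" where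
  "hook_prod (Node v ts) = Suc (sum_list (map tree_size ts)) * prod_list (map hook_prod ts)"

lemma hook_prod_pos: "hook_prod T > 0"
  by (induction T) (auto simp: prod_list_zero_iff simp flip: neq0_conv)

text \<open>Every subtree other than T and the chosen child carries over intact, so all other
  factors agree. Denominators are cleared to stay in \<open>nat\<close>.\<close>

lemma hook_prod_contract:
  assumes "i < length (children T)"
  shows "hook_prod (contract T i) * tree_size (children T ! i) * tree_size T
       = (tree_size T - 1) * hook_prod T"
proof -
  obtain v ts where T: "T = Node v ts" by (cases T)
  obtain w us where w: "ts ! i = Node w us" by (cases "ts ! i")
  have "ts = take i ts @ Node w us # drop (Suc i) ts"
    using assms T w id_take_nth_drop[of i ts] by simp
  then have ts: "prod_list (map hook_prod ts)
      = prod_list (map hook_prod (take i ts @ Node w us # drop (Suc i) ts))"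
    by (rule arg_cong)
  have size: "Suc (sum_list (map tree_size (take i ts @ us @ drop (Suc i) ts)))
      = sum_list (map tree_size ts)"
    using tree_size_contract[OF assms] T w by (simp add: contract_def)
  have "hook_prod (contract T i) =
      sum_list (map tree_size ts) * prod_list (map hook_prod (take i ts @ us @ drop (Suc i) ts))"
    using T w size by (simp add: contract_def)
  then show ?thesis
    using T w ts by (simp add: algebra_simps)
qed

lemma branches_Sem:
  assumes "children T \<noteq> []"
  shows "branches (Sem T) =
    map ((#) (root T)) (concat (map (\<lambda>i. branches (Sem (contract T i))) [0..<length (children T)]))"
  using assms by (subst Sem.simps) (simp add: comp_def)

lemma runs_eq:
  assumes "children T \<noteq> []"
  shows "runs T = (#) (root T) ` (\<Union>i<length (children T). runs (contract T i))"
  using assms by (simp add: runs_def branches_Sem lessThan_atLeast0)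

lemma branches_Sem_leaf: "children T = [] \<Longrightarrow> branches (Sem T) = [[root T]]"
  by (cases T) (simp add: Sem.simps)

lemma hd_runs: "r \<in> runs T \<Longrightarrow> r \<noteq> [] \<and> hd r = root T"
  unfolding runs_def using hd_branches by fastforce

text \<open>Hook length formula, by induction along contractions: each contraction contributes in
  proportion to the size of the chosen child, and these sizes add up to |T| - 1.\<close>

lemma length_branches_Sem: "length (branches (Sem T)) * hook_prod T = fact (tree_size T)"
proof (induction T rule: Sem.induct)
  case (1 T)
  show ?case
  proof (cases "children T = []")
    case True
    then show ?thesis by (cases T) (simp add: Sem.simps)
  next
    case False
    let ?I = "[0..<length (children T)]"
    define n where "n = tree_size T"
    define N where "N i = length (branches (Sem (contract T i)))" for i
    define S where "S i = tree_size (children T ! i)" for i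
    have n: "n = Suc (n - 1)" unfolding n_def by (cases T) simp
    have "map tree_size (children T) = map S ?I"
      by (rule nth_equalityI) (simp_all add: S_def)
    then have sum_S: "sum_list (map S ?I) = n - 1"
      using sum_list_tree_size_children[of T] by (simp add: n_def)
    have pos: "n - 1 > 0"
    proof -
      obtain t ts where "children T = t # ts"
        using False by (cases "children T") auto
      then show ?thesis
        unfolding n_def by (cases T; cases t) auto
    qed
    \<comment> \<open>Scaling by \<open>(n - 1) * hook_prod T\<close> makes every summand the same
      multiple of \<open>S i\<close>, so that \<open>sum_S\<close> evaluates the sum; the factor
      \<open>n - 1\<close> is cancelled at the end by \<open>pos\<close>.\<close>
    have step: "N i * ((n - 1) * hook_prod T) = S i * (fact (n - 1) * n)" if "i \<in> set ?I" for i
    proof -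
      have i: "i < length (children T)" using that by simp
      have size: "tree_size (contract T i) = n - 1"
        using tree_size_contract[OF i] by (simp add: n_def)
      have c: "N i * hook_prod (contract T i) = fact (n - 1)"
        using 1[OF False that] size by (simp add: N_def)
      have "S i * (fact (n - 1) * n) = N i * (hook_prod (contract T i) * S i * n)"
        using c by simp
      then show ?thesis
        using hook_prod_contract[OF i] by (simp add: S_def n_def)
    qed
    have "length (branches (Sem T)) * ((n - 1) * hook_prod T)
        = sum_list (map (\<lambda>i. N i * ((n - 1) * hook_prod T)) ?I)"
      using False by (simp add: branches_Sem length_concat comp_def sum_list_mult_const N_def)
    also have "\<dots> = sum_list (map (\<lambda>i. S i * (fact (n - 1) * n)) ?I)"
      using step by (intro arg_cong[where f = sum_list] map_cong) auto
    also have "\<dots> = (n - 1) * (n * fact (n - 1))"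
      by (simp add: sum_list_mult_const sum_S)
    also have "n * fact (n - 1) = fact n"
      using n by (metis fact_Suc of_nat_id)
    finally show ?thesis
      using pos by (simp add: n_def)
  qed
qed

text \<open>Distinct names keep the branches distinct, so the hook length formula passes from the
  list to the set.\<close>

lemma card_runs:
  assumes "process_tree T"
  shows "card (runs T) = length (branches (Sem T))"
  using distinct_branches_Sem[OF assms] by (simp add: runs_def distinct_card)

lemma finite_runs: "finite (runs T)"
  by (simp add: runs_def)

lemma card_runs_pos:
  assumes "process_tree T"
  shows "card (runs T) > 0"
  using length_branches_Sem[of T] card_runs[OF assms] by (metis fact_nonzero gr0I mult_zero_left)

text \<open>Quotient of the hook length formulas for T and its contraction: a share |T(v_i)| / (|T|
  - 1) of the runs moves to v_i first.\<close>

lemma card_runs_contract: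
  assumes "process_tree T" and i: "i < length (children T)"
  shows "card (runs (contract T i)) * (tree_size T - 1)
       = card (runs T) * tree_size (children T ! i)"
proof -
  let ?c = "card (runs (contract T i))" and ?n = "tree_size T" and ?s = "tree_size (children T ! i)"
  have n: "?n = Suc (tree_size (contract T i))"
    using tree_size_contract[OF i] by simp
  have c: "?c * hook_prod (contract T i) = fact (?n - 1)"
    using card_runs[OF process_tree_contract[OF assms]] length_branches_Sem[of "contract T i"] n
    by simp
  have "?c * (?n - 1) * hook_prod T = ?c * (hook_prod (contract T i) * ?s * ?n)"
    using hook_prod_contract[OF i] by simp
  also have "\<dots> = ?n * fact (?n - 1) * ?s"
    using c by simp
  also have "?n * fact (?n - 1) = fact ?n"
    using n by simp
  also have "\<dots> = card (runs T) * hook_prod T"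
    using card_runs[OF assms(1)] length_branches_Sem[of T] by simp
  finally have "(?c * (?n - 1)) * hook_prod T = (card (runs T) * ?s) * hook_prod T"
    by (simp only: ac_simps)
  then show ?thesis
    using hook_prod_pos[of T] by simp
qed

subsection \<open>Prefix probabilities\<close>

lemma prefix_probability_eq_card:
  assumes "process_tree T"
  shows "prefix_probability T \<sigma> = card {r \<in> runs T. prefix \<sigma> r} / card (runs T)"
proof -
  have "runs T \<noteq> {}"
    using card_runs_pos[OF assms] by auto
  moreover have "runs T \<inter> {r. prefix \<sigma> r} = {r \<in> runs T. prefix \<sigma> r}"
    by auto
  ultimately show ?thesis
    unfolding prefix_probability_def by (simp add: measure_pmf_of_set finite_runs)
qed

lemma prefix_probability_root:
  assumes "process_tree T"
  shows "prefix_probability T [root T] = 1"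
proof -
  have "{r \<in> runs T. prefix [root T] r} = runs T"
    using hd_runs by (fastforce simp: prefix_def neq_Nil_conv)
  then show ?thesis
    using card_runs_pos[OF assms] by (simp add: prefix_probability_eq_card[OF assms])
qed

text \<open>The second entry of a run names the contracted child, and siblings have distinct names,
  so the prefix determines the contraction.\<close>

lemma runs_with_prefix_Cons:
  assumes "process_tree T" and i: "i < length (children T)"
    and s: "s \<noteq> []" "hd s = root (children T ! i)"
  shows "{r \<in> runs T. prefix (root T # s) r} = (#) (root T) ` {r \<in> runs (contract T i). prefix s r}"
proof -
  have unique: "j = i" if j: "j < length (children T)" and r: "r \<in> runs (contract T j)" "prefix s r" for j r
  proof -
    have "root (children T ! j) = root (children T ! i)"
      using hd_runs[OF r(1)] r(2) s by (auto simp: prefix_def)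
    moreover have "distinct (map root (children T))"
      using assms(1) by (cases T) (simp add: process_tree_def distinct_roots)
    ultimately show ?thesis
      using i j by (metis length_map nth_eq_iff_index_eq nth_map)
  qed
  have children: "children T \<noteq> []"
    using i by auto
  have "{r \<in> runs T. prefix (root T # s) r}
      = (#) (root T) ` {r. \<exists>j < length (children T). r \<in> runs (contract T j) \<and> prefix s r}"
    unfolding runs_eq[OF children] by (auto intro!: imageI)
  also have "{r. \<exists>j < length (children T). r \<in> runs (contract T j) \<and> prefix s r}
      = {r \<in> runs (contract T i). prefix s r}"
    using unique i by blast
  finally show ?thesis .
qed

text \<open>Chain rule: the chance of the first move times the probability of the rest, since the
  runs that start with this move are in bijection with the runs of the contraction.\<close>

lemma prefix_probability_Cons:
  assumes "process_tree T" and i: "i < length (children T)"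
    and "s \<noteq> []" "hd s = root (children T ! i)"
  shows "prefix_probability T (root T # s)
       = tree_size (children T ! i) / (real (tree_size T) - 1) * prefix_probability (contract T i) s"
proof -
  let ?c = "card (runs (contract T i))" and ?n = "real (tree_size T)"
  have proc: "process_tree (contract T i)"
    using assms(1) i by (rule process_tree_contract)
  have n: "tree_size T = Suc (tree_size (contract T i))" "tree_size (contract T i) > 0"
    using tree_size_contract[OF i] by (simp, cases "contract T i") auto
  have "?c * real (tree_size T - 1) = card (runs T) * real (tree_size (children T ! i))"
    using card_runs_contract[OF assms(1) i] by (metis of_nat_mult)
  then have "tree_size (children T ! i) / (?n - 1) = ?c / card (runs T)"
    using n card_runs_pos[OF assms(1)] by (simp add: field_simps)
  moreover have "card {r \<in> runs T. prefix (root T # s) r} = card {r \<in> runs (contract T i). prefix s r}"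
    by (simp add: runs_with_prefix_Cons[OF assms] card_image)
  ultimately show ?thesis
    using card_runs_pos[OF proc]
    by (simp add: prefix_probability_eq_card[OF proc] prefix_probability_eq_card[OF assms(1)])
qed

lemma run_prefix_Cons:
  assumes "run_prefix T (x # s)"
  shows "x = root T"
    and "s \<noteq> [] \<Longrightarrow> \<exists>i < length (children T).
      hd s = root (children T ! i) \<and> run_prefix (contract T i) s"
proof -
  obtain r where r: "r \<in> runs T" "prefix (x # s) r"
    using assms by (auto simp: run_prefix_def)
  show "x = root T"
    using hd_runs[OF r(1)] r(2) by (auto simp: prefix_def)
  assume s: "s \<noteq> []"
  \<comment> \<open>The only run of a leaf is too short to extend a prefix with at least two
    entries.\<close>
  have children: "children T \<noteq> []"
  proof
    assume "children T = []"
    then have "r = [root T]" using r(1) by (simp add: runs_def branches_Sem_leaf)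
    then show False using r(2) s by (auto simp: prefix_def)
  qed
  then obtain i r' where i: "i < length (children T)" and r': "r' \<in> runs (contract T i)"
    and "r = root T # r'"
    using r(1) by (auto simp: runs_eq)
  then have pre: "prefix s r'" using r(2) by simp
  then have "hd s = root (children T ! i)"
    using hd_runs[OF r'] s by (auto simp: prefix_def)
  then show "\<exists>i < length (children T). hd s = root (children T ! i) \<and> run_prefix (contract T i) s"
    using i r' pre by (auto simp: run_prefix_def)
qed

subsection \<open>Weights of the proper descendants of the root\<close>

text \<open>The root is left out because contraction changes its hook: v_i becomes the root of a
  tree of size |T| - 1, while \<open>W\<close> still stores |T(v_i)|.\<close>

definition descendants :: "'a ptree \<Rightarrow> 'a ptree set" where
  "descendants T = (\<Union>t \<in> set (children T). subtrees t)"

lemma subtrees_refl: "T \<in> subtrees T"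
  by (cases T) simp

text \<open>Lets the assumption on the stored weights pass to the contraction in the induction along
  the prefix.\<close>

lemma descendants_contract:
  assumes "i < length (children T)"
  shows "descendants (contract T i) \<subseteq> descendants T"
proof -
  have "children T ! i \<in> set (children T)"
    using assms by simp
  moreover have "descendants (children T ! i) \<subseteq> subtrees (children T ! i)"
    by (cases "children T ! i") (auto simp: descendants_def)
  ultimately show ?thesis
    unfolding descendants_def contract_def by (auto dest: in_set_takeD in_set_dropD)
qed

lemma root_subtree_in_nodes: "S \<in> subtrees T \<Longrightarrow> root S \<in> set (nodes T)"
  by (induction T) auto

text \<open>Makes the description in \<open>subtree\<close> unique: a name shared by two subtrees
  puts both inside the same child.\<close>

lemma inj_on_root_subtrees: "distinct (nodes T) \<Longrightarrow> inj_on root (subtrees T)"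
proof (induction T)
  case (Node v ts)
  have dist: "distinct (concat (map nodes ts))" and v: "v \<notin> set (concat (map nodes ts))"
    using Node.prems by auto
  have "S = S'" if t: "t \<in> set ts" "S \<in> subtrees t" and t': "t' \<in> set ts" "S' \<in> subtrees t'"
    and eq: "root S = root S'" for t t' S S'
  proof -
    have "root S \<in> set (nodes t) \<inter> set (nodes t')"
      using root_subtree_in_nodes[OF t(2)] root_subtree_in_nodes[OF t'(2)] eq by simp
    \<comment> \<open>If \<open>t'\<close> lay in \<open>as\<close> or \<open>bs\<close>, the common
      name would occur twice in the concatenation.\<close>
    moreover obtain as bs where "ts = as @ t # bs"
      using t(1) split_list by metis
    ultimately have "t = t'"
      using dist t'(1) by auto
    moreover have "distinct (nodes t)"
      using dist t(1) by (auto simp: distinct_concat_iff)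
    ultimately show ?thesis
      using Node.IH[OF t(1)] t(2) t'(2) eq by (auto dest: inj_onD)
  qed
  moreover have "root S \<noteq> v" if "t \<in> set ts" "S \<in> subtrees t" for t S
    using v that root_subtree_in_nodes[OF that(2)] by auto
  ultimately show ?case
    unfolding inj_on_def by (simp del: ball_simps) metis
qed

lemma weighting_subtree:
  assumes "process_tree T" "weighting T W" "S \<in> subtrees T"
  shows "W (root S) = tree_size S"
proof -
  have "subtree T (root S) = S"
    unfolding subtree_def using assms inj_on_root_subtrees[of T]
    by (intro the_equality) (auto simp: process_tree_def dest: inj_onD)
  then show ?thesis
    using assms root_subtree_in_nodes[OF assms(3)] by (simp add: weighting_def)
qed

text \<open>Iterates the chain rule. The weights are assumed correct below the root only, as this
  survives contraction while \<open>weighting\<close> in general does not.\<close>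

lemma prefix_probability_eq_prod:
  assumes "process_tree T" "run_prefix T \<sigma>" "\<sigma> \<noteq> []"
    and "\<And>S. S \<in> descendants T \<Longrightarrow> W (root S) = tree_size S"
  shows "prefix_probability T \<sigma> = (\<Prod>i = 1..<length \<sigma>. W (\<sigma> ! i) / (real (tree_size T) - real i))"
  using assms
proof (induction \<sigma> arbitrary: T)
  case (Cons x s)
  note x = run_prefix_Cons(1)[OF Cons.prems(2)]
  show ?case
  proof (cases "s = []")
    case True
    then show ?thesis using prefix_probability_root[OF Cons.prems(1)] x by simp
  next
    case False
    then obtain i where i: "i < length (children T)" and hd: "hd s = root (children T ! i)"
      and pre: "run_prefix (contract T i) s"
      using run_prefix_Cons(2)[OF Cons.prems(2)] by blast
    have W: "W (s ! 0) = tree_size (children T ! i)"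
    proof -
      have "children T ! i \<in> descendants T"
        using i subtrees_refl nth_mem unfolding descendants_def by blast
      then show ?thesis
        using Cons.prems(4) hd False by (simp add: hd_conv_nth)
    qed
    have size: "real (tree_size T) = real (tree_size (contract T i)) + 1"
      using tree_size_contract[OF i] by simp
    let ?f = "\<lambda>j. W ((x # s) ! j) / (real (tree_size T) - real j)"
    \<comment> \<open>Shifting the index by one offsets the loss of one node in the contraction:
      (|T| - 1) - j = |T| - (j + 1). The factor at index 1 is the probability of the first
      move.\<close>
    have "prod ?f {1..<length (x # s)} = prod (\<lambda>j. ?f (Suc j)) {0..<length s}"
      using prod.shift_bounds_Suc_ivl[of ?f 0 "length s"] by simp
    also have "\<dots> = ?f 1 * prod (\<lambda>j. ?f (Suc j)) {1..<length s}"
      using False by (simp add: prod.atLeast_Suc_lessThan)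
    also have "prod (\<lambda>j. ?f (Suc j)) {1..<length s} = prefix_probability (contract T i) s"
      using Cons.IH[OF process_tree_contract[OF Cons.prems(1) i] pre False]
        Cons.prems(4) descendants_contract[OF i] size by force
    also have "?f 1 * \<dots> = prefix_probability T (x # s)"
      using prefix_probability_Cons[OF Cons.prems(1) i False hd] W x by simp
    finally show ?thesis by simp
  qed
qed simp

section \<open>Result and cost of the algorithm\<close>

lemma prefix_prob_alg_eq:
  "prefix_prob_alg W n \<sigma> = Counted (\<Prod>i = 1..<length \<sigma>. W (\<sigma> ! i) / (real n - real i))
     (length \<sigma> - 1) (3 * (length \<sigma> - 1))"
proof -
  let ?q = "\<lambda>i. W (\<sigma> ! i) / (real n - real i)"
  let ?body = "\<lambda>i \<rho>. sub_op (real n) (real i) \<bind>\<^sub>c (\<lambda>d.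
    div_op (real (W (\<sigma> ! i))) d \<bind>\<^sub>c (\<lambda>q. mul_op \<rho> q))"
  \<comment> \<open>Generalised over the index list and the accumulator for the induction; each
    iteration costs one subtraction, one division and one multiplication.\<close>
  have "for_loop is ?body \<rho> = Counted (\<rho> * prod_list (map ?q is)) (length is) (3 * length is)"
    for "is" \<rho>
    by (induction "is" arbitrary: \<rho>)
      (simp_all add: done_with_def and_then_def sub_op_def div_op_def mul_op_def)
  then show ?thesis
    by (simp add: prefix_prob_alg_def flip: prod.distinct_set_conv_list)
qed

theorem proposition35:
  shows "\<exists>ops :: nat \<Rightarrow> nat.
    (\<lambda>p. real (ops p)) \<in> \<Theta>(\<lambda>p. real p) \<and>
    (\<forall>(T :: 'a ptree) W n \<sigma> p.
       process_tree T \<and> weighting T W \<and> tree_size T = n \<and>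
       run_prefix T \<sigma> \<and> length \<sigma> = p \<and> 1 \<le> p \<and> p \<le> n \<longrightarrow>
         result (prefix_prob_alg W n \<sigma>) = prefix_probability T \<sigma> \<and>
         steps (prefix_prob_alg W n \<sigma>) = p - 1 \<and>
         arith_ops (prefix_prob_alg W n \<sigma>) = ops p)"
\<comment> \<open>The witness is the exact operation count, three per iteration.\<close>
proof (intro exI[of _ "\<lambda>p. 3 * (p - 1)"] conjI allI impI)
  show "(\<lambda>p. real (3 * (p - 1))) \<in> \<Theta>(\<lambda>p. real p)"
  proof (rule bigthetaI')
    show "\<forall>\<^sub>F p in sequentially. 1 * norm (real p) \<le> norm (real (3 * (p - 1))) \<and>
        norm (real (3 * (p - 1))) \<le> 3 * norm (real p)"
      \<comment> \<open>For p = 1 the count is 0 and the lower bound fails; from p = 2 on, p \<le> 3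
        * (p - 1).\<close>
      using eventually_ge_at_top[of 2] by eventually_elim auto
  qed simp_all
next
  fix T :: "'a ptree" and W n \<sigma> p
  assume *: "process_tree T \<and> weighting T W \<and> tree_size T = n \<and>
       run_prefix T \<sigma> \<and> length \<sigma> = p \<and> 1 \<le> p \<and> p \<le> n"
  have "W (root S) = tree_size S" if "S \<in> descendants T" for S
    using * that weighting_subtree[of T W S] by (cases T) (auto simp: descendants_def)
  then show "result (prefix_prob_alg W n \<sigma>) = prefix_probability T \<sigma>"
    using * prefix_probability_eq_prod[of T \<sigma> W] by (force simp: prefix_prob_alg_eq)
qed (auto simp: prefix_prob_alg_eq)

end
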